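(* Let $N$ be a finite nilpotent group. For every prime $p$, put $d_p=|N_p|$, where $N_p$ is the Sylow $p$-subgroup of $N$, with $d_p=1$ if $p\notin\pi(N)$. Then $$\gamma(A_5\times N)=\frac{5}{4d_2+1}+\frac{10}{3d_3+1}+\frac{6}{5d_5+1}+\sum_{q\in\pi(N)\setminus\{2,3,5\}}\frac{1}{d_q+1}.$$ Equivalently, $$\gamma(A_5\times N)-\frac92=\left(\frac{5}{4d_2+1}-1\right)+\left(\frac{10}{3d_3+1}-\frac52\right)+\left(\frac{6}{5d_5+1}-1\right)+\sum_{q\in\pi(N)\setminus\{2,3,5\}}\frac{1}{d_q+1}.$$ Therefore $\gamma(A_5\times N)=\frac92$ if and only if $$\sum_{q\in\pi(N)\setminus\{2,3,5\}}\frac{1}{d_q+1}=\left(1-\frac{5}{4d_2+1}\right)+\left(\frac52-\frac{10}{3d_3+1}\right)+\left(1-\frac{6}{5d_5+1}\right).$$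
   Context: $A_5$ is the alternating group of degree $5$. For a finite group $G$, $\pi(G)$ is the set of primes dividing $|G|$; for $p\in\pi(G)$, $\nu_p(G)$ is the number of Sylow $p$-subgroups of $G$ and $\sigma_p(G)$ is their common order. The Sylow-integral invariant is $$\gamma(G)=\int_0^1\sum_{p\in\pi(G)}\nu_p(G)x^{\sigma_p(G)}\,dx=\sum_{p\in\pi(G)}\frac{\nu_p(G)}{\sigma_p(G)+1}.$$ In a finite nilpotent group $N$ the Sylow $p$-subgroup $N_p$ is unique; $N_p=1$ when $p\notin\pi(N)$. *)

theory Defs
  imports "HOL-Analysis.Analysis" "HOL-Algebra.Sym_Groups" "HOL-Algebra.Sylow"
begin

text \<open>\<open>order\<close> is qualified throughout, since \<open>Polynomial.order\<close> is also in scope.\<close>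

primrec lower_central_series :: "('a, 'b) monoid_scheme \<Rightarrow> nat \<Rightarrow> 'a set" where
  "lower_central_series G 0 = carrier G"
| "lower_central_series G (Suc n) =
     generate G {x \<otimes>\<^bsub>G\<^esub> y \<otimes>\<^bsub>G\<^esub> inv\<^bsub>G\<^esub> x \<otimes>\<^bsub>G\<^esub> inv\<^bsub>G\<^esub> y | x y.
       x \<in> lower_central_series G n \<and> y \<in> carrier G}"

definition nilpotent_group :: "('a, 'b) monoid_scheme \<Rightarrow> bool" where
  "nilpotent_group G \<longleftrightarrow> group G \<and> (\<exists>n. lower_central_series G n = {\<one>\<^bsub>G\<^esub>})"

definition order_primes :: "('a, 'b) monoid_scheme \<Rightarrow> nat set" where
  "order_primes G = {p. prime p \<and> p dvd Coset.order G}"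

definition sylow_subgroups :: "nat \<Rightarrow> ('a, 'b) monoid_scheme \<Rightarrow> 'a set set" where
  "sylow_subgroups p G =
     {P. subgroup P G \<and> card P = p ^ multiplicity p (Coset.order G)}"

definition sylow_number :: "nat \<Rightarrow> ('a, 'b) monoid_scheme \<Rightarrow> nat" where
  "sylow_number p G = card (sylow_subgroups p G)"

definition sylow_order :: "nat \<Rightarrow> ('a, 'b) monoid_scheme \<Rightarrow> nat" where
  "sylow_order p G = (THE k. \<forall>P \<in> sylow_subgroups p G. card P = k)"

text \<open>Only meaningful when \<open>G\<close> has exactly one Sylow \<open>p\<close>-subgroup, as in a finite nilpotent group.\<close>

definition the_sylow_subgroup :: "nat \<Rightarrow> ('a, 'b) monoid_scheme \<Rightarrow> 'a set" where
  "the_sylow_subgroup p G = (THE P. P \<in> sylow_subgroups p G)"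

definition sylow_integral :: "('a, 'b) monoid_scheme \<Rightarrow> real" where
  "sylow_integral G =
     integral {0..1} (\<lambda>x::real. \<Sum>p\<in>order_primes G. real (sylow_number p G) * x ^ sylow_order p G)"

lemma sylow_integral_eq_sum:
  "sylow_integral G =
    (\<Sum>p\<in>order_primes G. real (sylow_number p G) / (real (sylow_order p G) + 1))"
proof -
  have mono: "((\<lambda>x::real. c * x ^ k) has_integral c / (real k + 1)) {0..1}" for c :: real and k
  proof -
    have "((\<lambda>x::real. c * x ^ k) has_integral
        (c / (real k + 1) * 1 ^ Suc k - c / (real k + 1) * 0 ^ Suc k)) {0..1}"
    proof (rule fundamental_theorem_of_calculus)
      fix x :: real
      have "((\<lambda>x. c / (real k + 1) * x ^ Suc k) has_real_derivative c * x ^ k) (at x within {0..1})"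
        by (rule derivative_eq_intros refl | simp add: field_simps)+
      then show "((\<lambda>x. c / (real k + 1) * x ^ Suc k) has_vector_derivative c * x ^ k)
          (at x within {0..1})"
        by (rule has_real_derivative_iff_has_vector_derivative[THEN iffD1])
    qed simp
    then show ?thesis by simp
  qed
  have "((\<lambda>x::real. \<Sum>p\<in>order_primes G. real (sylow_number p G) * x ^ sylow_order p G) has_integral
      (\<Sum>p\<in>order_primes G. real (sylow_number p G) / (real (sylow_order p G) + 1))) {0..1}"
  proof (cases "finite (order_primes G)")
    case True
    then show ?thesis by (intro has_integral_sum mono)
  qed simp
  then show ?thesis
    unfolding sylow_integral_def by (rule integral_unique)
qed

lemma (in group) sylow_order_eq:
  assumes "finite (carrier G)" "prime p"
  shows "sylow_subgroups p G \<noteq> {}"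
    and "sylow_order p G = p ^ multiplicity p (Coset.order G)"
proof -
  have "p ^ multiplicity p (Coset.order G) dvd Coset.order G"
    by (rule multiplicity_dvd)
  then obtain m where "Coset.order G = p ^ multiplicity p (Coset.order G) * m" ..
  from sylow_thm[OF assms(2) is_group this assms(1)]
  show ne: "sylow_subgroups p G \<noteq> {}"
    by (auto simp: sylow_subgroups_def)
  then obtain P where P: "P \<in> sylow_subgroups p G" by blast
  show "sylow_order p G = p ^ multiplicity p (Coset.order G)"
    unfolding sylow_order_def
    by (rule the_equality) (use P in \<open>auto simp: sylow_subgroups_def\<close>)
qed

end

theory Submission
  imports Defs "HOL-Algebra.Multiplicative_Group" "HOL-Algebra.Zassenhaus"
begin

text \<open>
  The Sylow numbers of a direct product are the products of the Sylow numbers of the factors, and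
  so are the Sylow orders: a Sylow \<open>p\<close>-subgroup of \<open>G \<times> H\<close> is contained in the product of its two
  projections, which are \<open>p\<close>-groups, and comparing orders makes it equal to that product and both
  projections Sylow (\<open>sylow_subgroups_DirProd\<close>). A finite nilpotent group has a single Sylow
  \<open>p\<close>-subgroup for each \<open>p\<close> (\<open>nilpotent_sylow_unique\<close>). Hence \<open>A\<^sub>5 \<times> N\<close> has as many Sylow
  \<open>p\<close>-subgroups as \<open>A\<^sub>5\<close>, each of order \<open>d\<^sub>p\<close> times the \<open>p\<close>-part of \<open>60 = 2\<^sup>2 * 3 * 5\<close>. Each of the
  primes \<open>2\<close>, \<open>3\<close>, \<open>5\<close> contributes the term with its Sylow number in \<open>A\<^sub>5\<close>, every other prime
  contributes \<open>1 / (d\<^sub>q + 1)\<close>, and the two remaining assertions are rearrangements of this sum.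

  Normality of a Sylow subgroup \<open>P\<close> of a nilpotent group comes from two facts. A subgroup of a
  nilpotent group that equals its own normalizer is the whole group, because such a subgroup
  absorbs the lower central series from the bottom upwards. And the normalizer of \<open>P\<close> equals its own
  normalizer, because \<open>P\<close> is normal in it and is therefore its only Sylow \<open>p\<close>-subgroup.

  It remains to find the Sylow numbers \<open>5\<close>, \<open>10\<close>, \<open>6\<close> of \<open>A\<^sub>5\<close>. Two distinct subgroups of prime
  order \<open>p\<close> meet trivially, so for \<open>p = 3\<close> and \<open>p = 5\<close> it is enough to count the \<open>20\<close> elements of order
  \<open>3\<close> and the \<open>24\<close> elements of order \<open>5\<close>. For \<open>p = 2\<close>, the Sylow subgroups correspond to the points
  of \<open>{1..5}\<close>: every involution of \<open>A\<^sub>5\<close> fixes exactly one point, commuting involutions fix the same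
  one, and the identity together with the involutions fixing a given point forms a Klein four-group.
  The finitely many facts about elements of \<open>A\<^sub>5\<close> behind these counts are checked by rewriting over
  an explicit list of its elements.
\<close>

section \<open>Sylow subgroups of finite nilpotent groups\<close>

text \<open>
  The image of \<open>x\<close> in the quotient by \<open>H\<close> has an order dividing both \<open>|H|\<close> and the index of \<open>H\<close>, so
  it is trivial. This element-wise form identifies the subgroups of order \<open>|H|\<close> without a formula
  for the order of a product of subgroups.
\<close>
lemma (in group) normal_coprime_index_contains:
  assumes H: "H \<lhd> G"
    and cop: "coprime (card H) (card (rcosets H))"
    and x: "x \<in> carrier G" "x [^] card H = \<one>"
  shows "x \<in> H"
proof -
  interpret H: normal H G by (fact H)
  interpret Q: group "G Mod H" by (rule H.factorgroup_is_group)
  have HxQ: "H #> x \<in> carrier (G Mod H)"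
    using x(1) by (auto simp: FactGroup_def RCOSETS_def)
  have "(H #> x) [^]\<^bsub>G Mod H\<^esub> card H = \<one>\<^bsub>G Mod H\<^esub>"
    using x H.subset by (simp add: H.FactGroup_pow)
  then have "Q.ord (H #> x) dvd card H"
    using HxQ Q.pow_eq_id by blast
  moreover have "Q.ord (H #> x) dvd card (rcosets H)"
    using Q.ord_dvd_group_order[OF HxQ] by (simp add: Coset.order_def FactGroup_def)
  ultimately have "Q.ord (H #> x) = 1"
    using cop by (metis coprime_common_divisor_nat)
  then have "H #> x = H"
    using Q.ord_eq_1[OF HxQ] by simp
  then show "x \<in> H"
    using x(1) H.subgroup_axioms by (rule coset_join1)
qed

lemma (in group) sylow_coprime_index:
  assumes fin: "finite (carrier G)" and p: "prime p" and P: "P \<in> sylow_subgroups p G"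
  shows "coprime (card P) (card (rcosets P))"
proof -
  let ?a = "multiplicity p (Coset.order G)"
  have P': "subgroup P G" "card P = p ^ ?a"
    using P by (auto simp: sylow_subgroups_def)
  have o: "Coset.order G \<noteq> 0" "\<not> is_unit p"
    using fin order_gt_0_iff_finite p not_prime_unit by auto
  from multiplicity_decompose'[OF this] obtain m where
    m: "Coset.order G = p ^ ?a * m" "\<not> p dvd m" by auto
  have "card (rcosets P) * card P = m * card P"
    using lagrange[OF P'(1)] m(1) P'(2) by (metis mult.commute)
  then have "card (rcosets P) = m"
    using P'(2) p by (simp add: prime_gt_0_nat)
  then show ?thesis
    using m(2) p P'(2) by (simp add: prime_imp_coprime)
qed

lemma (in group) subgroup_pow_card:
  assumes "subgroup H G" "x \<in> H"
  shows "x [^] card H = \<one>"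
proof -
  interpret H: group "G\<lparr>carrier := H\<rparr>"
    using assms(1) by (rule subgroup_imp_group)
  show ?thesis
    using H.pow_order_eq_1[of x] assms(2)
    by (simp add: Coset.order_def flip: nat_pow_consistent)
qed

lemma (in group) sylow_subgroups_of_normal:
  assumes fin: "finite (carrier G)" and p: "prime p"
    and P: "P \<in> sylow_subgroups p G" and nP: "P \<lhd> G"
  shows "sylow_subgroups p G = {P}"
proof -
  have "Q = P" if Q: "Q \<in> sylow_subgroups p G" for Q
  proof (rule card_subset_eq)
    show "finite P"
      using P fin by (auto simp: sylow_subgroups_def dest: subgroup.subset finite_subset)
    show cards: "card Q = card P"
      using P Q by (simp add: sylow_subgroups_def)
    show "Q \<subseteq> P"
    proof
      fix x assume x: "x \<in> Q"
      have "subgroup Q G"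
        using Q by (simp add: sylow_subgroups_def)
      then show "x \<in> P"
        using normal_coprime_index_contains[OF nP sylow_coprime_index[OF fin p P]]
          subgroup_pow_card[of Q x] x cards subgroup.mem_carrier by metis
    qed
  qed
  then show ?thesis
    using P by blast
qed

lemma (in group) lower_central_series_subset: "lower_central_series G n \<subseteq> carrier G"
proof (induction n)
  case (Suc n)
  then show ?case
    unfolding lower_central_series.simps by (intro generate_incl) auto
qed simp

text \<open>
  If \<open>H\<close> contains the term \<open>i + 1\<close> of the lower central series, then each element of the term \<open>i\<close>
  has all its commutators with \<open>H\<close> inside \<open>H\<close>, so it normalizes \<open>H\<close> and lies in \<open>H\<close>. Descending from
  the trivial term to the term \<open>0\<close> gives the whole group.
\<close>
lemma (in group) nilpotent_self_normalizing_imp_all: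
  assumes nil: "nilpotent_group G" and H: "subgroup H G"
    and self: "\<And>x. x \<in> carrier G \<Longrightarrow> (\<And>h. h \<in> H \<Longrightarrow> x \<otimes> h \<otimes> inv x \<in> H) \<Longrightarrow> x \<in> H"
  shows "H = carrier G"
proof -
  interpret H: subgroup H G by (fact H)
  obtain n where n: "lower_central_series G n = {\<one>}"
    using nil by (auto simp: nilpotent_group_def)
  have "lower_central_series G 0 \<subseteq> H"
  proof (rule inc_induct[of 0 n])
    show "lower_central_series G n \<subseteq> H"
      using n by simp
  next
    fix i assume IH: "lower_central_series G (Suc i) \<subseteq> H"
    show "lower_central_series G i \<subseteq> H"
    proof
      fix x assume x: "x \<in> lower_central_series G i"
      then have xG: "x \<in> carrier G"
        using lower_central_series_subset by blast
      show "x \<in> H"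
      proof (rule self[OF xG])
        fix h assume h: "h \<in> H"
        have "x \<otimes> h \<otimes> inv x \<otimes> inv h \<in> lower_central_series G (Suc i)"
          using x h by (fastforce intro: generate.incl)
        then have "x \<otimes> h \<otimes> inv x \<otimes> inv h \<otimes> h \<in> H"
          using IH h by blast
        then show "x \<otimes> h \<otimes> inv x \<in> H"
          using xG h by (simp add: m_assoc)
      qed
    qed
  qed simp
  then show ?thesis
    using H.subset by simp
qed

text \<open>
  The order of \<open>M\<close> lies, for divisibility, between \<open>|Q|\<close> and \<open>|G|\<close>, so its \<open>p\<close>-part is that of \<open>|G|\<close>.
\<close>
lemma (in group) sylow_in_subgroup:
  assumes fin: "finite (carrier G)" and p: "prime p" and M: "subgroup M G"
    and Q: "Q \<in> sylow_subgroups p G" "Q \<subseteq> M"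
  shows "Q \<in> sylow_subgroups p (G\<lparr>carrier := M\<rparr>)"
proof -
  interpret M: group "G\<lparr>carrier := M\<rparr>"
    using M by (rule subgroup_imp_group)
  have sQ: "subgroup Q G" "card Q = p ^ multiplicity p (Coset.order G)"
    using Q by (auto simp: sylow_subgroups_def)
  have sQM: "subgroup Q (G\<lparr>carrier := M\<rparr>)"
    using subgroup_incl[OF sQ(1) M Q(2)] .
  have d1: "Coset.order (G\<lparr>carrier := M\<rparr>) dvd Coset.order G"
    using lagrange[OF M, symmetric] by (simp add: Coset.order_def)
  have d2: "card Q dvd Coset.order (G\<lparr>carrier := M\<rparr>)"
    using M.lagrange[OF sQM] by (metis dvd_triv_right)
  have "Coset.order G \<noteq> 0" "\<not> is_unit p"
    using fin order_gt_0_iff_finite p not_prime_unit by auto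
  then have "multiplicity p (Coset.order (G\<lparr>carrier := M\<rparr>)) = multiplicity p (Coset.order G)"
    using d1 d2 sQ(2) by (intro antisym dvd_imp_multiplicity_le multiplicity_geI) auto
  then show ?thesis
    using sQM sQ(2) by (simp add: sylow_subgroups_def)
qed

text \<open>
  A conjugate of \<open>P\<close> by an element normalizing the normalizer \<open>M\<close> of \<open>P\<close> is again a Sylow subgroup of
  \<open>M\<close>, in which \<open>P\<close> is normal and hence the only one. So that element normalizes \<open>P\<close>, and \<open>M\<close> is
  self-normalizing.
\<close>
lemma (in group) nilpotent_sylow_normal:
  assumes fin: "finite (carrier G)" and nil: "nilpotent_group G"
    and p: "prime p" and P: "P \<in> sylow_subgroups p G"
  shows "P \<lhd> G"
proof -
  let ?M = "normalizer G P"
  have sP: "subgroup P G"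
    using P by (simp add: sylow_subgroups_def)
  have M: "subgroup ?M G"
    using normalizer_imp_subgroup[OF subgroup.subset[OF sP]] .
  have nP: "P \<lhd> G\<lparr>carrier := ?M\<rparr>"
    using sP by (rule subgroup_in_normalizer)
  interpret M: group "G\<lparr>carrier := ?M\<rparr>"
    using M by (rule subgroup_imp_group)
  have PM: "P \<subseteq> ?M"
    using subgroup.subset[OF normal_imp_subgroup[OF nP]] by simp
  have finM: "finite (carrier (G\<lparr>carrier := ?M\<rparr>))"
    using finite_subset[OF subgroup.subset[OF M] fin] by simp
  have uniq: "sylow_subgroups p (G\<lparr>carrier := ?M\<rparr>) = {P}"
    using M.sylow_subgroups_of_normal[OF finM p _ nP] sylow_in_subgroup[OF fin p M P PM] by blast
  have "?M = carrier G"
  proof (rule nilpotent_self_normalizing_imp_all[OF nil M])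
    fix x assume x: "x \<in> carrier G" and xM: "\<And>h. h \<in> ?M \<Longrightarrow> x \<otimes> h \<otimes> inv x \<in> ?M"
    let ?Q = "x <# P #> inv x"
    have PG: "P \<subseteq> carrier G" using subgroup.subset[OF sP] .
    have Q_eq: "?Q = (\<lambda>h. x \<otimes> h \<otimes> inv x) ` P"
      by (auto simp: l_coset_def r_coset_def)
    have "card ?Q = card P"
      unfolding Q_eq using x PG by (intro card_image inj_onI) (simp add: subset_iff)
    then have "?Q \<in> sylow_subgroups p G"
      using P subgroup_conjugation_is_surj2[OF x sP] by (simp add: sylow_subgroups_def)
    moreover have "?Q \<subseteq> ?M"
      unfolding Q_eq using PM xM by blast
    ultimately have "?Q = P"
      using sylow_in_subgroup[OF fin p M] uniq by blast
    then show "x \<in> ?M"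
      using x PG by (simp add: normalizer_def stabilizer_def)
  qed
  then show ?thesis
    using nP by simp
qed

corollary (in group) nilpotent_sylow_unique:
  assumes "finite (carrier G)" "nilpotent_group G" "prime p"
  shows "sylow_subgroups p G = {the_sylow_subgroup p G}"
proof -
  obtain P where P: "P \<in> sylow_subgroups p G"
    using sylow_order_eq(1)[OF assms(1,3)] by blast
  have "sylow_subgroups p G = {P}"
    using sylow_subgroups_of_normal[OF assms(1,3) P] nilpotent_sylow_normal[OF assms P] .
  then show ?thesis
    by (simp add: the_sylow_subgroup_def)
qed

section \<open>Sylow subgroups of direct products\<close>

text \<open>
  The image is isomorphic to a quotient of \<open>S\<close>, so Lagrange's theorem applies.
\<close>
lemma (in group_hom) card_image_dvd_card:
  assumes S: "subgroup S G"
  shows "card (h ` S) dvd card S"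
proof -
  interpret S: group "G\<lparr>carrier := S\<rparr>"
    using S by (rule G.subgroup_imp_group)
  interpret T: group "H\<lparr>carrier := h ` S\<rparr>"
    using subgroup_img_is_subgroup[OF S] by (rule H.subgroup_imp_group)
  interpret hS: group_hom "G\<lparr>carrier := S\<rparr>" "H\<lparr>carrier := h ` S\<rparr>" h
    using subgroup.mem_carrier[OF S]
    by unfold_locales (auto simp: hom_def)
  let ?K = "kernel (G\<lparr>carrier := S\<rparr>) (H\<lparr>carrier := h ` S\<rparr>) h"
  have "card (rcosets\<^bsub>G\<lparr>carrier := S\<rparr>\<^esub> ?K) = card (h ` S)"
    using iso_same_card[OF hS.FactGroup_iso] by (simp add: FactGroup_def)
  then show ?thesis
    using S.lagrange[OF hS.subgroup_kernel] by (auto simp: Coset.order_def intro: dvdI[OF sym])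
qed

lemma fst_group_hom: "group G \<Longrightarrow> group H \<Longrightarrow> group_hom (G \<times>\<times> H) G fst"
  by (simp add: group_hom_def group_hom_axioms_def DirProd_group hom_def mult_DirProd' Pi_def)

lemma snd_group_hom: "group G \<Longrightarrow> group H \<Longrightarrow> group_hom (G \<times>\<times> H) H snd"
  by (simp add: group_hom_def group_hom_axioms_def DirProd_group hom_def mult_DirProd' Pi_def)

lemma order_DirProd: "Coset.order (G \<times>\<times> H) = Coset.order G * Coset.order H"
  by (simp add: Coset.order_def card_cartesian_product)

lemma (in group_hom) card_image_prime_power_le:
  assumes finH: "finite (carrier H)" and p: "prime p"
    and S: "subgroup S G" and cS: "card S = p ^ k"
  shows "card (h ` S) \<le> p ^ multiplicity p (Coset.order H)"
proof -
  have "card (h ` S) dvd p ^ k"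
    using card_image_dvd_card[OF S] cS by simp
  then obtain j where j: "card (h ` S) = p ^ j"
    using p by (auto simp: divides_primepow_nat)
  have "card (h ` S) dvd Coset.order H"
    using H.lagrange[OF subgroup_img_is_subgroup[OF S]] by (metis dvd_triv_right)
  moreover have "Coset.order H \<noteq> 0"
    using H.order_gt_0_iff_finite finH by simp
  ultimately have "j \<le> multiplicity p (Coset.order H)"
    using p j by (intro multiplicity_geI) (auto simp: not_prime_unit)
  then show ?thesis
    using j power_increasing[OF _ prime_ge_1_nat[OF p]] by simp
qed

text \<open>
  The factors of a Sylow subgroup \<open>S\<close> are its projections: their orders are powers of \<open>p\<close> bounded by
  the \<open>p\<close>-parts of the orders of the two groups, while the product of these \<open>p\<close>-parts is \<open>|S|\<close>, which
  is at most the product of the orders of the projections.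
\<close>
lemma sylow_subgroups_DirProd:
  assumes "group G" "group H" "finite (carrier G)" "finite (carrier H)" "prime p"
  shows "sylow_subgroups p (G \<times>\<times> H) =
    (\<lambda>(P, Q). P \<times> Q) ` (sylow_subgroups p G \<times> sylow_subgroups p H)"
proof -
  interpret G: group G by fact
  interpret H: group H by fact
  interpret f: group_hom "G \<times>\<times> H" G fst using assms(1,2) by (rule fst_group_hom)
  interpret s: group_hom "G \<times>\<times> H" H snd using assms(1,2) by (rule snd_group_hom)
  let ?a = "multiplicity p (Coset.order G)" and ?b = "multiplicity p (Coset.order H)"
  have mult: "multiplicity p (Coset.order (G \<times>\<times> H)) = ?a + ?b"
    using assms G.order_gt_0_iff_finite H.order_gt_0_iff_finite
    by (simp add: order_DirProd prime_elem_multiplicity_mult_distrib)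
  show ?thesis
  proof (intro equalityI subsetI)
    fix S assume "S \<in> sylow_subgroups p (G \<times>\<times> H)"
    then have S: "subgroup S (G \<times>\<times> H)" "card S = p ^ (?a + ?b)"
      by (auto simp: sylow_subgroups_def mult)
    have A: "subgroup (fst ` S) G" and B: "subgroup (snd ` S) H"
      using f.subgroup_img_is_subgroup[OF S(1)] s.subgroup_img_is_subgroup[OF S(1)] by auto
    have finAB: "finite (fst ` S \<times> snd ` S)"
      using subgroup.subset[OF A] subgroup.subset[OF B] assms(3,4)
      by (auto intro: finite_subset)
    have cA: "card (fst ` S) \<le> p ^ ?a" and cB: "card (snd ` S) \<le> p ^ ?b"
      using f.card_image_prime_power_le[OF assms(3,5) S] s.card_image_prime_power_le[OF assms(4,5) S]
      by auto
    have sub: "S \<subseteq> fst ` S \<times> snd ` S"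
      by force
    have "p ^ ?a * p ^ ?b \<le> card (fst ` S) * card (snd ` S)"
      using card_mono[OF finAB sub] S(2) by (simp add: card_cartesian_product power_add)
    moreover have pos: "0 < p ^ ?a" "0 < p ^ ?b"
      using assms(5) by (simp_all add: prime_gt_0_nat)
    ultimately have "\<not> card (fst ` S) < p ^ ?a \<and> \<not> card (snd ` S) < p ^ ?b"
      using cA cB mult_less_le_imp_less[of "card (fst ` S)" "p ^ ?a" "card (snd ` S)" "p ^ ?b"]
        mult_le_less_imp_less[of "card (fst ` S)" "p ^ ?a" "card (snd ` S)" "p ^ ?b"]
      by (cases "card (fst ` S) = 0"; cases "card (snd ` S) = 0") auto
    with cA cB have "card (fst ` S) = p ^ ?a" "card (snd ` S) = p ^ ?b"
      by auto
    moreover from this have "S = fst ` S \<times> snd ` S"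
      using S(2) by (intro card_subset_eq[OF finAB sub]) (simp add: card_cartesian_product power_add)
    ultimately have "fst ` S \<in> sylow_subgroups p G" "snd ` S \<in> sylow_subgroups p H"
        "S = fst ` S \<times> snd ` S"
      using A B by (simp_all add: sylow_subgroups_def)
    then show "S \<in> (\<lambda>(P, Q). P \<times> Q) ` (sylow_subgroups p G \<times> sylow_subgroups p H)"
      by (intro image_eqI[of _ _ "(fst ` S, snd ` S)"]) (simp_all only: prod.case mem_Sigma_iff simp_thms)
  next
    fix S assume "S \<in> (\<lambda>(P, Q). P \<times> Q) ` (sylow_subgroups p G \<times> sylow_subgroups p H)"
    then show "S \<in> sylow_subgroups p (G \<times>\<times> H)"
      using DirProd_subgroups[OF assms(1) _ assms(2)]
      by (auto simp: sylow_subgroups_def mult card_cartesian_product power_add)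
  qed
qed

lemma sylow_subgroups_nonempty: "P \<in> sylow_subgroups p G \<Longrightarrow> P \<noteq> {}"
  by (auto simp: sylow_subgroups_def dest: subgroup.one_closed)

lemma sylow_number_DirProd:
  assumes "group G" "group H" "finite (carrier G)" "finite (carrier H)" "prime p"
  shows "sylow_number p (G \<times>\<times> H) = sylow_number p G * sylow_number p H"
proof -
  have "inj_on (\<lambda>(P, Q). P \<times> Q) (sylow_subgroups p G \<times> sylow_subgroups p H)"
    by (intro inj_onI) (auto simp: times_eq_iff dest: sylow_subgroups_nonempty)
  then show ?thesis
    using sylow_subgroups_DirProd[OF assms]
    by (simp add: sylow_number_def card_image card_cartesian_product)
qed

section \<open>Sylow subgroups of the alternating group of degree five\<close>

lemma (in group) prime_card_subgroup_eq_generate: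
  assumes p: "prime p" and P: "subgroup P G" "card P = p" and x: "x \<in> P" "x \<noteq> \<one>"
  shows "P = generate G {x}" and "x [^] p = \<one>"
proof -
  have xG: "x \<in> carrier G"
    using P(1) x(1) by (rule subgroup.mem_carrier)
  interpret P: group "G\<lparr>carrier := P\<rparr>"
    using P(1) by (rule subgroup_imp_group)
  show xp: "x [^] p = \<one>"
    using P.pow_order_eq_1[of x] x(1) P(2)
    by (simp add: Coset.order_def flip: nat_pow_consistent)
  then have "ord x dvd p" "ord x \<noteq> 1"
    using pow_eq_id[OF xG] ord_eq_1[OF xG] x(2) by auto
  then have "ord x = p"
    using p prime_nat_iff by blast
  then have "card (generate G {x}) = card P"
    using generate_pow_card[OF xG] P(2) by simp
  moreover have "generate G {x} \<subseteq> P"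
    using generate_subgroup_incl[OF _ P(1)] x(1) by simp
  moreover have "finite P"
    using P(2) p by (metis card.infinite not_prime_0)
  ultimately show "P = generate G {x}"
    by (metis card_subset_eq)
qed

text \<open>
  Each subgroup of prime order is generated by any of its non-trivial elements, so these subgroups
  partition the elements of order \<open>p\<close> into classes of size \<open>p - 1\<close>.
\<close>
lemma (in group) card_prime_card_subgroups:
  assumes fin: "finite (carrier G)" and p: "prime p"
  shows "card {P. subgroup P G \<and> card P = p} * (p - 1) =
    card {x \<in> carrier G. x \<noteq> \<one> \<and> x [^] p = \<one>}"
proof -
  let ?S = "{P. subgroup P G \<and> card P = p}"
  have finS: "finite ?S"
    using fin by (intro finite_subset[of ?S "Pow (carrier G)"]) (auto dest: subgroup.subset)
  have "{x \<in> carrier G. x \<noteq> \<one> \<and> x [^] p = \<one>} = (\<Union>P\<in>?S. P - {\<one>})"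
  proof (intro equalityI subsetI)
    fix x assume x: "x \<in> {x \<in> carrier G. x \<noteq> \<one> \<and> x [^] p = \<one>}"
    then have "ord x dvd p" "ord x \<noteq> 1"
      using pow_eq_id ord_eq_1 by auto
    then have "ord x = p"
      using p prime_nat_iff by blast
    then have "generate G {x} \<in> ?S"
      using x generate_pow_card[of x] generate_is_subgroup[of "{x}"] by auto
    moreover have "x \<in> generate G {x} - {\<one>}"
      using x by (auto intro: generate.incl)
    ultimately show "x \<in> (\<Union>P\<in>?S. P - {\<one>})"
      by blast
  next
    fix x assume "x \<in> (\<Union>P\<in>?S. P - {\<one>})"
    then show "x \<in> {x \<in> carrier G. x \<noteq> \<one> \<and> x [^] p = \<one>}"
      using prime_card_subgroup_eq_generate(2)[OF p] by (auto dest: subgroup.mem_carrier)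
  qed
  also have "card \<dots> = (\<Sum>P\<in>?S. card (P - {\<one>}))"
  proof (rule card_UN_disjoint[OF finS])
    show "\<forall>P\<in>?S. finite (P - {\<one>})"
      using fin by (auto dest: subgroup.subset intro: finite_subset)
    show "\<forall>P\<in>?S. \<forall>Q\<in>?S. P \<noteq> Q \<longrightarrow> (P - {\<one>}) \<inter> (Q - {\<one>}) = {}"
      using prime_card_subgroup_eq_generate(1)[OF p] by blast
  qed
  also have "\<dots> = (\<Sum>P\<in>?S. p - 1)"
    by (intro sum.cong refl) (auto simp: subgroup.one_closed)
  finally show ?thesis
    by simp
qed

text \<open>
  Each permutation of \<open>{1..5}\<close> is a product of transpositions \<open>(1 a) (2 b) (3 c) (4 d)\<close> with
  \<open>1 \<le> a\<close>, \<open>2 \<le> b\<close>, \<open>3 \<le> c\<close>, \<open>4 \<le> d\<close>, where a factor such as \<open>(1 1)\<close> is the identity. These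
  factorizations serve as an enumeration of the symmetric group from which the sign can be read off:
  it is determined by the number of non-trivial factors.
\<close>
definition perm_of_code :: "nat \<times> nat \<times> nat \<times> nat \<Rightarrow> nat \<Rightarrow> nat" where
  "perm_of_code = (\<lambda>(a, b, c, d).
    Transposition.transpose 1 a \<circ> (Transposition.transpose 2 b \<circ> (Transposition.transpose 3 c \<circ> Transposition.transpose 4 d)))"

definition sym5_codes :: "(nat \<times> nat \<times> nat \<times> nat) list" where
  "sym5_codes = List.product [1, 2, 3, 4, 5] (List.product [2, 3, 4, 5] (List.product [3, 4, 5] [4, 5]))"

text \<open>
  The nested equivalence holds exactly if an even number of the four equations fails, that is, if an
  even number of the transpositions are genuine.
\<close>
definition even_code :: "nat \<times> nat \<times> nat \<times> nat \<Rightarrow> bool" where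
  "even_code = (\<lambda>(a, b, c, d). (1 = a) = ((2 = b) = ((3 = c) = (4 = d))))"

definition alt5_codes :: "(nat \<times> nat \<times> nat \<times> nat) list" where
  "alt5_codes = filter even_code sym5_codes"

lemma evenperm_perm_of_code: "evenperm (perm_of_code x) \<longleftrightarrow> even_code x"
  by (cases x) (simp only: perm_of_code_def even_code_def prod.case
      evenperm_comp permutation_compose permutation_swap_id evenperm_swap)

lemma atLeastAtMost_1_5: "{1..5::nat} = {1, 2, 3, 4, 5}"
  by auto

text \<open>
  The parameter \<open>Q\<close> lets this be applied repeatedly as a rewrite rule that peels one point at a time
  off the permuted set.
\<close>
lemma ex_permutes_insert_iff:
  "(\<exists>p. p permutes insert a S \<and> Q p) \<longleftrightarrow>
    (\<exists>b\<in>insert a S. \<exists>p. p permutes S \<and> Q (Transposition.transpose a b \<circ> p))"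
proof -
  have "(\<exists>p. p permutes insert a S \<and> Q p) \<longleftrightarrow> (\<exists>p\<in>{p. p permutes insert a S}. Q p)"
    by blast
  then show ?thesis
    unfolding permutes_insert Bex_def image_iff
    by (simp only: mem_Collect_eq split_paired_Ex prod.case) blast
qed

lemma permutes_atLeastAtMost_5_iff:
  "p permutes {1..5::nat} \<longleftrightarrow> p \<in> perm_of_code ` set sym5_codes"
proof -
  have permutes_singleton: "q permutes {5::nat} \<longleftrightarrow> q = id" for q
    by simp
  have "p permutes {1..5} \<longleftrightarrow> (\<exists>q. q permutes {1, 2, 3, 4, 5} \<and> p = q)"
    unfolding atLeastAtMost_1_5 by blast
  also have "\<dots> \<longleftrightarrow> (\<exists>a\<in>{1, 2, 3, 4, 5}. \<exists>b\<in>{2, 3, 4, 5}. \<exists>c\<in>{3, 4, 5}. \<exists>d\<in>{4, 5}.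
      p = perm_of_code (a, b, c, d))"
    unfolding ex_permutes_insert_iff[of 1] ex_permutes_insert_iff[of 2]
      ex_permutes_insert_iff[of 3] ex_permutes_insert_iff[of 4] permutes_singleton perm_of_code_def prod.case
    by (simp only: simp_thms comp_id)
  also have "\<dots> \<longleftrightarrow> p \<in> perm_of_code ` set sym5_codes"
  proof -
    have "(\<exists>a\<in>A. \<exists>b\<in>B. \<exists>c\<in>C. \<exists>d\<in>D. p = perm_of_code (a, b, c, d)) \<longleftrightarrow>
        p \<in> perm_of_code ` (A \<times> B \<times> C \<times> D)" for A B C D
      by blast
    then show ?thesis
      unfolding sym5_codes_def set_product list.set .
  qed
  finally show ?thesis .
qed

lemma carrier_alt_group_5: "carrier (alt_group 5) = perm_of_code ` set alt5_codes"
  unfolding set_eq_iff alt_group_carrier permutes_atLeastAtMost_5_iff alt5_codes_def set_filter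
  using evenperm_perm_of_code by blast

lemma order_alt_group_5: "Coset.order (alt_group 5) = 60"
  using alt_group_card_carrier[of 5] by (simp add: Coset.order_def fact_numeral)

lemma length_alt5_codes: "length alt5_codes = 60"
  by (simp add: alt5_codes_def sym5_codes_def even_code_def)

lemma distinct_alt5_codes: "distinct alt5_codes"
  unfolding alt5_codes_def sym5_codes_def by (intro distinct_filter distinct_product) simp_all

text \<open>
  There are exactly as many even codes as even permutations, so the surjection from codes to
  permutations is injective and counting codes counts group elements.
\<close>
lemma card_alt_group_5_Collect:
  "card {x \<in> carrier (alt_group 5). Q x} = length (filter (\<lambda>c. Q (perm_of_code c)) alt5_codes)"
proof -
  have "card (set alt5_codes) = 60"
    using length_alt5_codes distinct_alt5_codes by (simp add: distinct_card)
  then have "inj_on perm_of_code (set alt5_codes)"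
    using order_alt_group_5 unfolding Coset.order_def carrier_alt_group_5
    by (intro eq_card_imp_inj_on) simp_all
  then have inj: "inj_on perm_of_code (set (filter (\<lambda>c. Q (perm_of_code c)) alt5_codes))"
    by (rule inj_on_subset) auto
  have "{x \<in> carrier (alt_group 5). Q x} =
      perm_of_code ` set (filter (\<lambda>c. Q (perm_of_code c)) alt5_codes)"
    unfolding carrier_alt_group_5 by auto
  then show ?thesis
    using distinct_alt5_codes card_image[OF inj] by (simp only: distinct_card distinct_filter)
qed

lemma alt_group_pow: "x [^]\<^bsub>alt_group n\<^esub> (k::nat) = x ^^ k"
  by (induction k) (auto simp: nat_pow_def alt_group_one alt_group_mult funpow_swap1 fun_eq_iff)

text \<open>
  Equality of a function with \<^term>\<open>id\<close> cannot be decided by rewriting; this condition on five values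
  can, and on \<open>A\<^sub>5\<close> it is the same.
\<close>
definition fixes_1_to_5 :: "(nat \<Rightarrow> nat) \<Rightarrow> bool" where
  "fixes_1_to_5 x \<longleftrightarrow> list_all (\<lambda>i. x i = i) [1, 2, 3, 4, 5]"

lemma fixes_1_to_5_id [simp]: "fixes_1_to_5 id"
  by (simp add: fixes_1_to_5_def)

lemma fixes_1_to_5_iff:
  assumes "x \<in> carrier (alt_group 5)"
  shows "fixes_1_to_5 x \<longleftrightarrow> x = id"
proof
  assume "fixes_1_to_5 x"
  then have "x i = i" if "i \<in> {1..5}" for i
    using that unfolding atLeastAtMost_1_5 by (auto simp: fixes_1_to_5_def)
  moreover have "x permutes {1..5}"
    using assms by (simp add: alt_group_carrier)
  ultimately have "x i = i" for i
    using permutes_not_in[of x "{1..5}" i] by (cases "i \<in> {1..5}") auto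
  then show "x = id" by auto
qed simp

lemma funpow_numeral_apply: "(f ^^ numeral k) i = f ((f ^^ pred_numeral k) i)"
  by (simp add: numeral_eq_Suc)

text \<open>
  Simplification with these rules evaluates a closed condition on all codes.
\<close>
lemmas eval_codes = alt5_codes_def sym5_codes_def even_code_def perm_of_code_def
  fixes_1_to_5_def Transposition.transpose_def funpow_numeral_apply

interpretation A5: group "alt_group 5"
  by (rule alt_group_is_group)

lemma finite_alt_group_5: "finite (carrier (alt_group 5))"
  using carrier_alt_group_5 by simp

lemma funpow_in_alt_group_5: "x \<in> carrier (alt_group 5) \<Longrightarrow> x ^^ k \<in> carrier (alt_group 5)"
  using A5.nat_pow_closed by (simp add: alt_group_pow)

lemma card_alt_group_5_pow_eq_one:
  "card {x \<in> carrier (alt_group 5). x \<noteq> \<one>\<^bsub>alt_group 5\<^esub> \<and> x [^]\<^bsub>alt_group 5\<^esub> (k::nat) = \<one>\<^bsub>alt_group 5\<^esub>} =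
    length (filter (\<lambda>c. \<not> fixes_1_to_5 (perm_of_code c) \<and> fixes_1_to_5 (perm_of_code c ^^ k)) alt5_codes)"
  unfolding card_alt_group_5_Collect[of "\<lambda>x. \<not> fixes_1_to_5 x \<and> fixes_1_to_5 (x ^^ k)", symmetric]
    alt_group_pow alt_group_one
  by (intro arg_cong[of _ _ card] Collect_cong)
    (auto simp: fixes_1_to_5_iff funpow_in_alt_group_5)

lemma multiplicity_60:
  "multiplicity 2 (60::nat) = 2" "multiplicity 3 (60::nat) = 1" "multiplicity 5 (60::nat) = 1"
  by (rule multiplicity_eqI; simp)+

lemma sylow_number_alt_group_5_prime:
  assumes "prime p" "multiplicity p (60::nat) = 1"
  shows "sylow_number p (alt_group 5) * (p - 1) =
    length (filter (\<lambda>c. \<not> fixes_1_to_5 (perm_of_code c) \<and> fixes_1_to_5 (perm_of_code c ^^ p)) alt5_codes)"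
  using A5.card_prime_card_subgroups[OF finite_alt_group_5 assms(1)] assms(2)
  by (simp add: sylow_number_def sylow_subgroups_def order_alt_group_5 card_alt_group_5_pow_eq_one)

lemma sylow_number_3_alt_group_5: "sylow_number 3 (alt_group 5) = 10"
proof -
  have "length (filter (\<lambda>c. \<not> fixes_1_to_5 (perm_of_code c) \<and> fixes_1_to_5 (perm_of_code c ^^ 3)) alt5_codes) = 20"
    by (simp add: eval_codes)
  then show ?thesis
    using sylow_number_alt_group_5_prime[of 3] multiplicity_60 by simp
qed

lemma sylow_number_5_alt_group_5: "sylow_number 5 (alt_group 5) = 6"
proof -
  have "length (filter (\<lambda>c. \<not> fixes_1_to_5 (perm_of_code c) \<and> fixes_1_to_5 (perm_of_code c ^^ 5)) alt5_codes) = 24"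
    by (simp add: eval_codes)
  then show ?thesis
    using sylow_number_alt_group_5_prime[of 5] multiplicity_60 by simp
qed

definition klein_four :: "nat \<Rightarrow> (nat \<Rightarrow> nat) set" where
  "klein_four i = {x \<in> carrier (alt_group 5). x i = i \<and> x ^^ 2 = id}"

lemma alt_group_5_all_iff:
  "(\<forall>x\<in>carrier (alt_group 5). Q x) \<longleftrightarrow> list_all (\<lambda>c. Q (perm_of_code c)) alt5_codes"
  by (simp add: carrier_alt_group_5 list_all_iff)

text \<open>
  A 4-cycle is odd, so \<open>A\<^sub>5\<close> has no element of order \<open>4\<close>.
\<close>
lemma alt_group_5_pow4:
  assumes "x \<in> carrier (alt_group 5)" "x ^^ 4 = id"
  shows "x ^^ 2 = id"
proof -
  have "\<forall>x\<in>carrier (alt_group 5). fixes_1_to_5 (x ^^ 4) \<longrightarrow> fixes_1_to_5 (x ^^ 2)"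
    unfolding alt_group_5_all_iff by (simp add: eval_codes)
  then show ?thesis
    using assms by (simp add: fixes_1_to_5_iff funpow_in_alt_group_5)
qed

text \<open>
  Transpositions being odd, the involutions of \<open>A\<^sub>5\<close> are the products of two disjoint transpositions.
\<close>
lemma alt_group_5_involution_fixpoint:
  assumes "x \<in> carrier (alt_group 5)" "x ^^ 2 = id" "x \<noteq> id"
  shows "\<exists>!i. i \<in> {1..5} \<and> x i = i"
proof -
  have *: "\<forall>x\<in>carrier (alt_group 5). fixes_1_to_5 (x ^^ 2) \<and> \<not> fixes_1_to_5 x \<longrightarrow>
      length (filter (\<lambda>i. x i = i) [1, 2, 3, 4, 5]) = 1"
    unfolding alt_group_5_all_iff by (simp add: eval_codes)
  define fs where "fs = filter (\<lambda>i. x i = i) [1, 2, 3, 4, 5]"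
  have "length fs = 1"
    unfolding fs_def using bspec[OF * assms(1)] assms
    by (simp only: fixes_1_to_5_iff fixes_1_to_5_id simp_thms)
  then obtain i where "fs = [i]"
    by (cases fs) auto
  then have "{j \<in> {1..5}. x j = j} = {i}"
    using set_filter[of "\<lambda>i. x i = i" "[1, 2, 3, 4, 5]"]
    unfolding fs_def atLeastAtMost_1_5 list.set by simp
  then show ?thesis
    by (intro ex1I[of _ i]) blast+
qed

lemma card_klein_four:
  assumes "i \<in> {1..5}"
  shows "card (klein_four i) = 4"
proof -
  have "klein_four i = {x \<in> carrier (alt_group 5). x i = i \<and> fixes_1_to_5 (x ^^ 2)}"
    by (auto simp: klein_four_def fixes_1_to_5_iff funpow_in_alt_group_5)
  moreover have "list_all (\<lambda>i. length (filter (\<lambda>c. perm_of_code c i = i \<and>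
      fixes_1_to_5 (perm_of_code c ^^ 2)) alt5_codes) = 4) [1, 2, 3, 4, 5]"
    by (simp add: eval_codes)
  ultimately show ?thesis
    using assms unfolding atLeastAtMost_1_5 by (auto simp: card_alt_group_5_Collect)
qed

text \<open>
  This is what makes \<open>klein_four i\<close> closed under multiplication: two double transpositions of the same
  four points have a product of the same kind.
\<close>
lemma klein_four_mult_pow2:
  assumes i: "i \<in> {1..5}" and xy: "x \<in> klein_four i" "y \<in> klein_four i"
  shows "(x \<circ> y) ^^ 2 = id"
proof -
  \<comment> \<open>Keeping the list of the four codes as an argument makes the simplifier compute it once,
    so that only 16 pairs remain for each point.\<close>
  define pairs where "pairs cs = list_all (\<lambda>c. list_all (\<lambda>d.
    fixes_1_to_5 ((perm_of_code c \<circ> perm_of_code d) ^^ 2)) cs) cs" for cs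
  define codes where "codes i = filter (\<lambda>c. perm_of_code c i = i \<and>
      fixes_1_to_5 (perm_of_code c ^^ 2)) alt5_codes" for i
  have "list_all (\<lambda>i. pairs (codes i)) [1, 2, 3, 4, 5]"
    by (simp add: pairs_def codes_def eval_codes)
  then have "pairs (codes i)"
    using i unfolding atLeastAtMost_1_5 by auto
  moreover obtain c d where "c \<in> set alt5_codes" "x = perm_of_code c" "d \<in> set alt5_codes" "y = perm_of_code d"
    using xy unfolding klein_four_def carrier_alt_group_5 by blast
  moreover from this have "c \<in> set (codes i)" "d \<in> set (codes i)"
    using xy by (auto simp: klein_four_def codes_def fixes_1_to_5_iff funpow_in_alt_group_5)
  ultimately have "fixes_1_to_5 ((x \<circ> y) ^^ 2)"
    by (auto simp: pairs_def list_all_iff)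
  moreover have "x \<circ> y \<in> carrier (alt_group 5)"
    using A5.m_closed[of x y] xy by (simp add: klein_four_def alt_group_mult)
  ultimately show ?thesis
    by (simp add: fixes_1_to_5_iff funpow_in_alt_group_5)
qed

lemma klein_four_subgroup:
  assumes i: "i \<in> {1..5}"
  shows "subgroup (klein_four i) (alt_group 5)"
proof (rule A5.subgroupI)
  show "klein_four i \<subseteq> carrier (alt_group 5)"
    by (auto simp: klein_four_def)
  show "klein_four i \<noteq> {}"
    using card_klein_four[OF i] by auto
next
  fix x assume x: "x \<in> klein_four i"
  then have "inv\<^bsub>alt_group 5\<^esub> x = x"
    by (intro A5.inv_equality)
      (auto simp: klein_four_def alt_group_mult alt_group_one numeral_2_eq_2)
  then show "inv\<^bsub>alt_group 5\<^esub> x \<in> klein_four i"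
    using x by simp
next
  fix x y assume "x \<in> klein_four i" "y \<in> klein_four i"
  then show "x \<otimes>\<^bsub>alt_group 5\<^esub> y \<in> klein_four i"
    using A5.m_closed[of x y] klein_four_mult_pow2[OF i]
    by (simp add: klein_four_def alt_group_mult)
qed

text \<open>
  A group of order \<open>4\<close> in \<open>A\<^sub>5\<close> has exponent \<open>2\<close>, so it is commutative. Its elements therefore permute
  the fixed points of any non-trivial element \<open>x\<close>; as there is only one such point \<open>i\<close>, the whole group
  fixes \<open>i\<close> and is contained in \<open>klein_four i\<close>, which also has order \<open>4\<close>.
\<close>
lemma sylow_subgroups_2_alt_group_5: "sylow_subgroups 2 (alt_group 5) = klein_four ` {1..5}"
proof (intro equalityI subsetI)
  fix S assume "S \<in> klein_four ` {1..5}"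
  then show "S \<in> sylow_subgroups 2 (alt_group 5)"
    using klein_four_subgroup card_klein_four
    by (auto simp: sylow_subgroups_def order_alt_group_5 multiplicity_60)
next
  fix S assume "S \<in> sylow_subgroups 2 (alt_group 5)"
  then have S: "subgroup S (alt_group 5)" "card S = 4"
    by (auto simp: sylow_subgroups_def order_alt_group_5 multiplicity_60)
  interpret S: subgroup S "alt_group 5" by (rule S(1))
  have sq: "x \<circ> x = id" if "x \<in> S" for x
  proof -
    have "x ^^ 4 = id"
      using A5.subgroup_pow_card[OF S(1) that] S(2) by (simp add: alt_group_pow alt_group_one)
    then show ?thesis
      using alt_group_5_pow4[OF S.mem_carrier[OF that]] by (simp add: numeral_2_eq_2)
  qed
  have "\<not> S \<subseteq> {id}"
    using S(2) card_mono[of "{id}" S] by auto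
  then obtain x where x: "x \<in> S" "x \<noteq> id"
    by blast
  have "x ^^ 2 = id"
    using sq[OF x(1)] by (simp add: numeral_2_eq_2)
  then obtain i where i: "i \<in> {1..5}" "x i = i" and uniq: "\<And>j. j \<in> {1..5} \<Longrightarrow> x j = j \<Longrightarrow> j = i"
    using alt_group_5_involution_fixpoint[OF S.mem_carrier[OF x(1)] _ x(2)] by blast
  have "y i = i" if y: "y \<in> S" for y
  proof -
    have "x \<circ> y \<in> S"
      using S.m_closed[OF x(1) y] by (simp add: alt_group_mult)
    then have "x (y (x (y i))) = i"
      using sq[of "x \<circ> y"] by (simp add: fun_eq_iff)
    \<comment> \<open>Applying \<open>x\<close> and then \<open>y\<close>, both of square one, turns \<open>x y x y = 1\<close> into
      the commutation of \<open>x\<close> and \<open>y\<close> at \<open>i\<close>.\<close>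
    then have "x (y i) = y (x i)"
      using sq[OF x(1)] sq[OF y] by (metis comp_apply id_apply)
    then have "x (y i) = y i"
      using i by simp
    moreover have "y i \<in> {1..5}"
      using S.mem_carrier[OF y] i(1) permutes_in_image[of y "{1..5}"]
      by (simp add: alt_group_carrier)
    ultimately show ?thesis
      using uniq by blast
  qed
  then have "S \<subseteq> klein_four i"
    using sq S.mem_carrier by (auto simp: klein_four_def numeral_2_eq_2)
  moreover have "finite (klein_four i)"
    using finite_alt_group_5 by (simp add: klein_four_def)
  ultimately have "S = klein_four i"
    using card_klein_four[OF i(1)] S(2) by (intro card_subset_eq) auto
  then show "S \<in> klein_four ` {1..5}"
    using i(1) by blast
qed

text \<open>
  A common non-trivial element of two of these groups has only one fixed point.
\<close>
lemma inj_on_klein_four: "inj_on klein_four {1..5}"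
proof (rule inj_onI)
  fix i j :: nat assume ij: "i \<in> {1..5}" "j \<in> {1..5}" "klein_four i = klein_four j"
  have "\<not> klein_four i \<subseteq> {id}"
    using card_klein_four[OF ij(1)] card_mono[of "{id}" "klein_four i"] by auto
  then obtain x where "x \<in> klein_four i" "x \<noteq> id"
    by blast
  then show "i = j"
    using ij alt_group_5_involution_fixpoint[of x] by (auto simp: klein_four_def)
qed

lemma sylow_number_2_alt_group_5: "sylow_number 2 (alt_group 5) = 5"
  unfolding sylow_number_def sylow_subgroups_2_alt_group_5
  using card_image[OF inj_on_klein_four] by simp

section \<open>The Sylow integral of the product\<close>

lemma (in group) sylow_number_eq_1_if_not_dvd:
  assumes "\<not> p dvd Coset.order G"
  shows "sylow_number p G = 1"
proof -
  have "sylow_subgroups p G = {{\<one>}}"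
  proof (intro equalityI subsetI)
    fix P assume P: "P \<in> sylow_subgroups p G"
    then have "card P = 1"
      using assms by (simp add: sylow_subgroups_def not_dvd_imp_multiplicity_0)
    moreover have "\<one> \<in> P"
      using P by (simp add: sylow_subgroups_def subgroup.one_closed)
    ultimately show "P \<in> {{\<one>}}"
      by (auto simp: card_1_singleton_iff)
  qed (use assms in \<open>simp add: sylow_subgroups_def not_dvd_imp_multiplicity_0 triv_subgroup\<close>)
  then show ?thesis
    by (simp add: sylow_number_def)
qed

lemma prime_dvd_60_iff:
  assumes "prime (p::nat)"
  shows "p dvd 60 \<longleftrightarrow> p \<in> {2, 3, 5}"
proof -
  have "(60::nat) = 2 * 2 * 3 * 5"
    by simp
  then have "p dvd 60 \<longleftrightarrow> p dvd 2 \<or> p dvd 3 \<or> p dvd 5"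
    using assms by (metis prime_dvd_mult_iff)
  then show ?thesis
    using assms by (auto simp: primes_dvd_imp_eq)
qed

text \<open>
  Outside \<open>{2, 3, 5}\<close> the Sylow number of \<open>A\<^sub>5\<close> is \<open>1\<close>, since the Sylow subgroup is trivial; this
  makes the terms of the remaining sum uniform.
\<close>
lemma sylow_integral_alt_group_5_DirProd:
  assumes fin: "finite (carrier N)" and nil: "nilpotent_group N"
    and d: "\<And>p. prime p \<Longrightarrow>
      d p = (if p \<in> order_primes N then card (the_sylow_subgroup p N) else 1)"
  shows "sylow_integral (alt_group 5 \<times>\<times> N) =
    5 / (4 * real (d 2) + 1) + 10 / (3 * real (d 3) + 1) + 6 / (5 * real (d 5) + 1)
    + (\<Sum>q \<in> order_primes N - {2, 3, 5}. 1 / (real (d q) + 1))"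
proof -
  let ?G = "alt_group 5 \<times>\<times> N"
  interpret N: group N
    using nil by (simp add: nilpotent_group_def)
  interpret G: group ?G
    by (rule DirProd_group[OF alt_group_is_group N.group_axioms])
  have finG: "finite (carrier ?G)"
    using fin finite_alt_group_5 by simp
  have ordN: "Coset.order N \<noteq> 0"
    using N.order_gt_0_iff_finite fin by simp
  \<comment> \<open>Since the \<open>p\<close>-part of \<open>|N|\<close> is \<open>1\<close> when \<open>p\<close> does not divide \<open>|N|\<close>, a single formula
    covers both cases in the definition of \<open>d\<close>.\<close>
  have d_eq: "d p = p ^ multiplicity p (Coset.order N)" if p: "prime p" for p
  proof (cases "p \<in> order_primes N")
    case True
    have "the_sylow_subgroup p N \<in> sylow_subgroups p N"
      using N.nilpotent_sylow_unique[OF fin nil p] by blast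
    then show ?thesis
      using d[OF p] True by (simp add: sylow_subgroups_def)
  next
    case False
    then show ?thesis
      using d[OF p] p by (simp add: order_primes_def not_dvd_imp_multiplicity_0)
  qed
  have number: "sylow_number p ?G = sylow_number p (alt_group 5)" if p: "prime p" for p
  proof -
    have "sylow_number p N = 1"
      unfolding sylow_number_def by (subst N.nilpotent_sylow_unique[OF fin nil p]) simp
    then show ?thesis
      using sylow_number_DirProd[OF alt_group_is_group N.group_axioms finite_alt_group_5 fin p] by simp
  qed
  have sorder: "sylow_order p ?G = p ^ multiplicity p 60 * d p" if p: "prime p" for p
    using G.sylow_order_eq(2)[OF finG p] p ordN
    by (simp add: order_DirProd order_alt_group_5 d_eq prime_elem_multiplicity_mult_distrib power_add)
  have primes: "order_primes ?G = {2, 3, 5} \<union> (order_primes N - {2, 3, 5})"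
    using prime_dvd_60_iff
    by (auto simp: order_primes_def order_DirProd order_alt_group_5 prime_dvd_mult_iff)
  have fin_primes: "finite (order_primes N)"
    using ordN by (intro finite_subset[OF _ finite_divisors_nat[of "Coset.order N"]]) (auto simp: order_primes_def)
  let ?t = "\<lambda>p. real (sylow_number p ?G) / (real (sylow_order p ?G) + 1)"
  have "sylow_integral ?G = sum ?t {2, 3, 5} + sum ?t (order_primes N - {2, 3, 5})"
    unfolding sylow_integral_eq_sum primes using fin_primes by (intro sum.union_disjoint) auto
  also have "sum ?t {2, 3, 5} =
      5 / (4 * real (d 2) + 1) + 10 / (3 * real (d 3) + 1) + 6 / (5 * real (d 5) + 1)"
    by (simp add: number sorder sylow_number_2_alt_group_5 sylow_number_3_alt_group_5
        sylow_number_5_alt_group_5 multiplicity_60)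
  also have "sum ?t (order_primes N - {2, 3, 5}) =
      (\<Sum>q \<in> order_primes N - {2, 3, 5}. 1 / (real (d q) + 1))"
  proof (rule sum.cong[OF refl])
    fix q assume q: "q \<in> order_primes N - {2, 3, 5}"
    then have "prime q" and nd: "\<not> q dvd 60"
      using prime_dvd_60_iff by (auto simp: order_primes_def)
    then show "?t q = 1 / (real (d q) + 1)"
      using number[of q] sorder[of q] A5.sylow_number_eq_1_if_not_dvd[of q]
      by (simp add: order_alt_group_5 not_dvd_imp_multiplicity_0)
  qed
  finally show ?thesis .
qed

theorem theorem3p2:
  fixes N :: "('a, 'b) monoid_scheme" and d :: "nat \<Rightarrow> nat"
  assumes "finite (carrier N)" and "nilpotent_group N"
    and "\<And>p. prime p \<Longrightarrow>
           d p = (if p \<in> order_primes N then card (the_sylow_subgroup p N) else 1)"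
  shows "(sylow_integral (alt_group 5 \<times>\<times> N) =
           5 / (4 * real (d 2) + 1) + 10 / (3 * real (d 3) + 1) + 6 / (5 * real (d 5) + 1)
           + (\<Sum>q \<in> order_primes N - {2, 3, 5}. 1 / (real (d q) + 1)))
         \<and> (sylow_integral (alt_group 5 \<times>\<times> N) - 9 / 2 =
           (5 / (4 * real (d 2) + 1) - 1) + (10 / (3 * real (d 3) + 1) - 5 / 2)
           + (6 / (5 * real (d 5) + 1) - 1)
           + (\<Sum>q \<in> order_primes N - {2, 3, 5}. 1 / (real (d q) + 1)))
         \<and> (sylow_integral (alt_group 5 \<times>\<times> N) = 9 / 2 \<longleftrightarrow>
           (\<Sum>q \<in> order_primes N - {2, 3, 5}. 1 / (real (d q) + 1)) =
           (1 - 5 / (4 * real (d 2) + 1)) + (5 / 2 - 10 / (3 * real (d 3) + 1))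
           + (1 - 6 / (5 * real (d 5) + 1)))"
  using sylow_integral_alt_group_5_DirProd[OF assms] by linarith

end
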